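(* Let $n\ge 1$ be an integer, let $1\le p_2\le p_1<\infty$, and let $\Psi:(0,\infty)\to(0,\infty)$ be a measurable function satisfying $\int_0^1\frac{\Psi(t)}{t}\,dt<\infty$. Then $S_{p_1,\Psi}\subseteq S_{p_2,\Psi}$.
   Context: For $1\le p<\infty$, a measurable function $\Psi:(0,\infty)\to(0,\infty)$ and $f\in L^p_{\rm loc}(\mathbb{R}^n)$, the Stummel $p$-modulus of $f$ is $$\eta_{p,\Psi}f(r):=\sup_{x\in\mathbb{R}^n}\left(\int_{|x-y|<r}\frac{|f(y)|^p\,\Psi(|x-y|)}{|x-y|^n}\,dy\right)^{1/p}\in[0,\infty],\quad r>0,$$ which is nondecreasing in $r$. The generalized Stummel $p$-class is $S_{p,\Psi}=S_{p,\Psi}(\mathbb{R}^n):=\{f\in L^p_{\rm loc}(\mathbb{R}^n):\ \eta_{p,\Psi}f(r)\searrow 0 \text{ as } r\searrow 0\}$, i.e. $\lim_{r\to0^+}\eta_{p,\Psi}f(r)=0$. *)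

theory Defs
  imports "HOL-Analysis.Analysis"
begin

text \<open>
  Functions on \<open>\<real>\<^sup>n\<close> are taken pointwise, not modulo null sets, and ``measurable'' means
  Lebesgue measurable throughout. The scalar type \<open>'k :: real_normed_field\<close> covers
  both the real and the complex scalars.
\<close>

definition Lp_loc :: "real \<Rightarrow> (real ^ 'n \<Rightarrow> 'k :: real_normed_field) set" where
  "Lp_loc p = {f. f \<in> borel_measurable lebesgue \<and>
     (\<forall>K. compact K \<longrightarrow> (\<integral>\<^sup>+ y\<in>K. ennreal (norm (f y) powr p) \<partial>lebesgue) < \<infinity>)}"

text \<open>The power \<open>a\<^sup>s\<close> of an extended nonnegative real \<open>a\<close>, for an exponent \<open>s > 0\<close>.\<close>

definition ennreal_powr :: "ennreal \<Rightarrow> real \<Rightarrow> ennreal" where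
  "ennreal_powr a s = (if a = \<infinity> then \<infinity> else ennreal (enn2real a powr s))"

text \<open>
  The modulus takes values in \<open>[0,\<infinity>]\<close>. The integrand at the single point \<open>y = x\<close>, where
  the denominator vanishes, is a null-set matter (there HOL's \<open>a / 0 = 0\<close> applies).
  Only the values of \<open>\<Psi>\<close> on \<open>(0,\<infinity>)\<close> matter.
\<close>

definition stummel_modulus ::
  "real \<Rightarrow> (real \<Rightarrow> real) \<Rightarrow> (real ^ 'n \<Rightarrow> 'k :: real_normed_field) \<Rightarrow> real \<Rightarrow> ennreal" where
  "stummel_modulus p \<Psi> f r =
     (SUP x. ennreal_powr
        (\<integral>\<^sup>+ y\<in>{y. norm (x - y) < r}.
           ennreal (norm (f y) powr p * \<Psi> (norm (x - y)) / norm (x - y) ^ CARD('n)) \<partial>lebesgue)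
        (1 / p))"

text \<open>
  The modulus is nondecreasing in \<open>r\<close>, so its decreasing to \<open>0\<close> is the same as
  convergence to \<open>0\<close> from the right.
\<close>

definition stummel_class ::
  "real \<Rightarrow> (real \<Rightarrow> real) \<Rightarrow> (real ^ 'n \<Rightarrow> 'k :: real_normed_field) set" where
  "stummel_class p \<Psi> = {f \<in> Lp_loc p. (stummel_modulus p \<Psi> f \<longlongrightarrow> 0) (at_right 0)}"

end

theory Submission
  imports Defs
begin

text \<open>
  Since \<open>a\<^sup>p \<le> 1 + a\<^sup>q\<close> for \<open>a \<ge> 0\<close> and \<open>0 \<le> p \<le> q\<close>, no Hoelder inequality is needed: the
  integral over \<open>|x - y| < r\<close> with exponent \<open>p2\<close> is at most the one with exponent \<open>p1\<close> plus
  the integral of the bare kernel \<open>\<Psi>(|x - y|) / |x - y|\<^sup>n\<close>. By polar coordinates the latter is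
  a constant multiple of the integral of \<open>\<Psi>(t) / t\<close> over \<open>(0, r)\<close>, which does not depend on
  \<open>x\<close> and tends to \<open>0\<close> with \<open>r\<close>.
\<close>

section \<open>Vanishing of the modulus, restated without roots and suprema\<close>

text \<open>On the nonnegative reals \<open>b powr s\<close> is increasing with inverse
  \<open>b powr (1 / s)\<close>, and an infinite \<open>a\<close> fails both bounds because
  \<open>e\<close> is real. This strips the root from the modulus.\<close>

lemma ennreal_powr_le_iff:
  assumes "s > 0" "e > 0"
  shows "ennreal_powr a s \<le> ennreal e \<longleftrightarrow> a \<le> ennreal (e powr (1 / s))"
proof (cases a)
  case top
  then show ?thesis by (simp add: ennreal_powr_def top_unique)
next
  case (real b)
  have "b powr s \<le> e \<longleftrightarrow> b \<le> e powr (1 / s)"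
  proof
    assume "b powr s \<le> e"
    then have "(b powr s) powr (1 / s) \<le> e powr (1 / s)"
      using assms by (intro powr_mono2) auto
    then show "b \<le> e powr (1 / s)"
      using real assms by (simp add: powr_powr)
  next
    assume "b \<le> e powr (1 / s)"
    then have "b powr s \<le> (e powr (1 / s)) powr s"
      using real assms by (intro powr_mono2) auto
    then show "b powr s \<le> e"
      using assms by (simp add: powr_powr)
  qed
  then show ?thesis
    using real assms by (simp add: ennreal_powr_def)
qed

text \<open>As 0 is the least element, only upper bounds matter. They are non-strict so that a bound
  on a supremum is equivalent to the same bound on every member.\<close>

lemma ennreal_tendsto_0_iff_le:
  fixes f :: "'a \<Rightarrow> ennreal"
  shows "(f \<longlongrightarrow> 0) F \<longleftrightarrow> (\<forall>e>0. eventually (\<lambda>x. f x \<le> ennreal e) F)"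
proof
  assume f: "(f \<longlongrightarrow> 0) F"
  show "\<forall>e>0. eventually (\<lambda>x. f x \<le> ennreal e) F"
  proof (intro allI impI)
    fix e :: real assume "e > 0"
    then have "eventually (\<lambda>x. f x < ennreal e) F"
      using f by (intro order_tendstoD) auto
    then show "eventually (\<lambda>x. f x \<le> ennreal e) F"
      by eventually_elim simp
  qed
next
  assume f: "\<forall>e>0. eventually (\<lambda>x. f x \<le> ennreal e) F"
  show "(f \<longlongrightarrow> 0) F"
  proof (rule order_tendstoI)
    fix a :: ennreal assume "0 < a"
    then obtain b where b: "0 < b" "b < a" using dense by blast
    then obtain e where e: "b = ennreal e" "e > 0"
      by (cases b) auto
    have "eventually (\<lambda>x. f x \<le> ennreal e) F" using f e by auto
    then show "eventually (\<lambda>x. f x < a) F"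
      by eventually_elim (use b e in auto)
  qed simp
qed

text \<open>A bound \<open>e\<close> on the modulus is a bound \<open>e powr p\<close> on all the
  integrals at once, and \<open>e powr p\<close> runs through all positive reals as \<open>e\<close>
  does. Integrals with different exponents can then be compared directly, uniformly in
  \<open>x\<close>.\<close>

lemma stummel_modulus_tendsto_0_iff:
  fixes f :: "real ^ 'n \<Rightarrow> 'k :: real_normed_field"
  assumes "p > 0"
  shows "(stummel_modulus p \<Psi> f \<longlongrightarrow> 0) (at_right 0) \<longleftrightarrow>
    (\<forall>e>0. eventually (\<lambda>r. \<forall>x. (\<integral>\<^sup>+ y\<in>{y. norm (x - y) < r}.
           ennreal (norm (f y) powr p * \<Psi> (norm (x - y)) / norm (x - y) ^ CARD('n)) \<partial>lebesgue)
        \<le> ennreal e) (at_right 0))"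
    (is "_ \<longleftrightarrow> (\<forall>e>0. eventually (\<lambda>r. \<forall>x. ?I r x \<le> ennreal e) _)")
proof -
  have le: "stummel_modulus p \<Psi> f r \<le> ennreal e \<longleftrightarrow> (\<forall>x. ?I r x \<le> ennreal (e powr p))"
    if "e > 0" for r e
    using assms that by (simp add: stummel_modulus_def SUP_le_iff ennreal_powr_le_iff)
  have "(\<forall>e>0. eventually (\<lambda>r. \<forall>x. ?I r x \<le> ennreal (e powr p)) (at_right 0)) \<longleftrightarrow>
    (\<forall>e>0. eventually (\<lambda>r. \<forall>x. ?I r x \<le> ennreal e) (at_right 0))" (is "?L \<longleftrightarrow> ?R")
  proof
    assume L: ?L
    show ?R
    proof (intro allI impI)
      fix e :: real assume "e > 0"
      then have "e powr (1 / p) > 0" "(e powr (1 / p)) powr p = e"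
        using assms by (auto simp: powr_powr)
      then show "eventually (\<lambda>r. \<forall>x. ?I r x \<le> ennreal e) (at_right 0)"
        using L[rule_format, of "e powr (1 / p)"] by (simp only:)
    qed
  next
    assume R: ?R
    show ?L
    proof (intro allI impI)
      fix e :: real assume "e > 0"
      then show "eventually (\<lambda>r. \<forall>x. ?I r x \<le> ennreal (e powr p)) (at_right 0)"
        by (intro R[rule_format]) simp
    qed
  qed
  moreover have "(stummel_modulus p \<Psi> f \<longlongrightarrow> 0) (at_right 0) \<longleftrightarrow>
      (\<forall>e>0. eventually (\<lambda>r. \<forall>x. ?I r x \<le> ennreal (e powr p)) (at_right 0))"
    unfolding ennreal_tendsto_0_iff_le by (simp only: le cong: imp_cong)
  ultimately show ?thesis by (simp only:)
qed

text \<open>Polar coordinates for radial functions; the density is read off from the volume of balls.\<close>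

lemma distr_norm_diff_lborel:
  fixes x :: "'a :: euclidean_space"
  shows "distr lborel borel (\<lambda>y. norm (x - y)) =
    density lborel (\<lambda>t. ennreal (DIM('a) * unit_ball_vol DIM('a) * t ^ (DIM('a) - 1)) * indicator {0..} t)"
    (is "?M = ?N")
proof -
  let ?d = "DIM('a)" and ?v = "unit_ball_vol (real DIM('a))"
  have ball: "emeasure ?M {..a} = ennreal (if a < 0 then 0 else ?v * a ^ ?d)" for a
  proof -
    have "(\<lambda>y. norm (x - y)) -` {..a} = cball x a"
      by (auto simp: dist_norm)
    then show ?thesis
      by (simp add: emeasure_distr emeasure_cball)
  qed
  show ?thesis
  \<comment> \<open>The half-lines \<open>{..a}\<close> form an intersection-stable generator, so it
    is enough to compare the two measures there: the preimage of \<open>{..a}\<close> is a closed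
    ball, and the density integrates to its volume.\<close>
  proof (rule measure_eqI_generator_eq[where E = "range atMost" and \<Omega> = UNIV and A = "\<lambda>i. {..real i}"])
    fix X :: "real set" assume "X \<in> range atMost"
    then obtain a where X: "X = {..a}" by auto
    have "emeasure ?N X = (\<integral>\<^sup>+ t. ennreal (?d * ?v * t ^ (?d - 1)) * indicator {0..a} t \<partial>lborel)"
      unfolding X by (subst emeasure_density) (auto intro!: nn_integral_cong simp: indicator_def)
    also have "\<dots> = ennreal (if a < 0 then 0 else ?v * a ^ ?d)"
    proof (cases "a < 0")
      case False
      have "(\<integral>\<^sup>+ t. ennreal (?d * ?v * t ^ (?d - 1)) * indicator {0..a} t \<partial>lborel) =
        ennreal (?v * a ^ ?d - ?v * 0 ^ ?d)"
        using False
        by (intro nn_integral_FTC_Icc) (auto intro!: derivative_eq_intros)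
      with False show ?thesis by (simp add: zero_power)
    qed auto
    finally show "emeasure ?M X = emeasure ?N X"
      by (simp add: ball X)
  next
    show "sets ?M = sigma_sets UNIV (range atMost)"
      by (simp add: borel_eq_atMost)
    show "sets ?N = sigma_sets UNIV (range atMost)"
      by (simp add: borel_eq_atMost)
    show "(\<Union>i. {..real i}) = UNIV"
      by (auto simp: real_arch_simple)
    show "emeasure ?M {..real i} \<noteq> \<infinity>" for i
      by (simp add: ball)
  qed (auto simp: Int_stable_def)
qed

text \<open>Since \<open>g\<close> is only Lebesgue measurable, it is replaced by a Borel function
  \<open>h\<close> equal to it almost everywhere; the change of variables is then done for
  \<open>h\<close>.\<close>

lemma
  fixes g :: "real \<Rightarrow> real" and x :: "'a :: euclidean_space"
  assumes "g \<in> borel_measurable lebesgue"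
  shows borel_measurable_lebesgue_radial: "(\<lambda>y. g (norm (x - y))) \<in> borel_measurable lebesgue"
    and nn_integral_lebesgue_radial: "(\<integral>\<^sup>+ y. ennreal (g (norm (x - y))) \<partial>lebesgue) =
      (\<integral>\<^sup>+ t\<in>{0..}. ennreal (DIM('a) * unit_ball_vol DIM('a) * t ^ (DIM('a) - 1) * g t) \<partial>lebesgue)"
proof -
  obtain h where h [measurable]: "h \<in> borel_measurable borel" and gh: "AE t in lborel. g t = h t"
    using completion_ex_borel_measurable_real[OF assms] by auto
  let ?w = "\<lambda>t. ennreal (DIM('a) * unit_ball_vol DIM('a) * t ^ (DIM('a) - 1)) * indicator {0..} t"
  \<comment> \<open>The image measure has a density, so the null set where \<open>g\<close> and
    \<open>h\<close> differ pulls back to a null set of points \<open>y\<close>.\<close>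
  have "AE t in density lborel ?w. g t = h t"
    using gh by (subst AE_density) auto
  then have "AE t in distr lborel borel (\<lambda>y. norm (x - y)). g t = h t"
    by (simp only: distr_norm_diff_lborel)
  then have ae: "AE y in lborel. g (norm (x - y)) = h (norm (x - y))"
    by (rule AE_distrD[rotated]) simp
  show "(\<lambda>y. g (norm (x - y))) \<in> borel_measurable lebesgue"
  proof (rule borel_measurable_AE)
    show "(\<lambda>y. h (norm (x - y))) \<in> borel_measurable lebesgue"
      by (intro measurable_completion) simp
    show "AE y in lebesgue. h (norm (x - y)) = g (norm (x - y))"
      using AE_completion[OF ae] by eventually_elim simp
  qed
  have "(\<integral>\<^sup>+ y. ennreal (g (norm (x - y))) \<partial>lebesgue) = (\<integral>\<^sup>+ y. ennreal (h (norm (x - y))) \<partial>lborel)"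
    unfolding nn_integral_completion using ae by (intro nn_integral_cong_AE) auto
  also have "\<dots> = (\<integral>\<^sup>+ t. ennreal (h t) \<partial>distr lborel borel (\<lambda>y. norm (x - y)))"
    by (subst nn_integral_distr) auto
  also have "\<dots> = (\<integral>\<^sup>+ t. ?w t * ennreal (h t) \<partial>lborel)"
    unfolding distr_norm_diff_lborel by (subst nn_integral_density) auto
  also have "\<dots> = (\<integral>\<^sup>+ t\<in>{0..}. ennreal (DIM('a) * unit_ball_vol DIM('a) * t ^ (DIM('a) - 1) * g t) \<partial>lebesgue)"
    unfolding nn_integral_completion using gh
    by (intro nn_integral_cong_AE) (auto simp: indicator_def simp flip: ennreal_mult')
  finally show "(\<integral>\<^sup>+ y. ennreal (g (norm (x - y))) \<partial>lebesgue) =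
      (\<integral>\<^sup>+ t\<in>{0..}. ennreal (DIM('a) * unit_ball_vol DIM('a) * t ^ (DIM('a) - 1) * g t) \<partial>lebesgue)" .
qed

section \<open>Small radii and comparison of exponents\<close>

text \<open>Dominated convergence along sequences \<open>S n\<close> in (0,1) that tend to 0, with
  the integrand on (0,1) as dominating function.\<close>

lemma nn_integral_near_0_tendsto_0:
  fixes g :: "real \<Rightarrow> ennreal"
  assumes "(\<lambda>t. g t * indicator {0<..<1} t) \<in> borel_measurable lebesgue"
    and "(\<integral>\<^sup>+ t\<in>{0<..<1}. g t \<partial>lebesgue) < \<infinity>"
  shows "((\<lambda>r. \<integral>\<^sup>+ t\<in>{0<..<r}. g t \<partial>lebesgue) \<longlongrightarrow> 0) (at_right 0)"
proof (rule tendsto_at_right_sequentially[of 0 1])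
  fix S :: "nat \<Rightarrow> real"
  assume S: "\<And>n. 0 < S n" "\<And>n. S n < 1" "S \<longlonglongrightarrow> 0"
  have "(\<lambda>n. \<integral>\<^sup>+ t\<in>{0<..<S n}. g t \<partial>lebesgue) \<longlonglongrightarrow> (\<integral>\<^sup>+ t. 0 \<partial>lebesgue :: real measure)"
  proof (rule nn_integral_dominated_convergence[where w = "\<lambda>t. g t * indicator {0<..<1} t"])
    fix n
    \<comment> \<open>Measurability of \<open>g\<close> is given only after cutting off to (0,1), so
      the integrand on the smaller interval is written as a restriction of that product.\<close>
    have "(\<lambda>t. (g t * indicator {0<..<1} t) * indicator {0<..<S n} t) \<in> borel_measurable lebesgue"
      by (intro borel_measurable_times_ennreal[OF assms(1)] borel_measurable_indicator) auto
    moreover have "(\<lambda>t. (g t * indicator {0<..<1} t) * indicator {0<..<S n} t) = (\<lambda>t. g t * indicator {0<..<S n} t)"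
      using S(2)[of n] by (auto simp: indicator_def)
    ultimately show "(\<lambda>t. g t * indicator {0<..<S n} t) \<in> borel_measurable lebesgue" by simp
    show "AE t in lebesgue. g t * indicator {0<..<S n} t \<le> g t * indicator {0<..<1} t"
      using S(2)[of n] by (auto simp: indicator_def)
  next
    show "AE t in lebesgue. (\<lambda>n. g t * indicator {0<..<S n} t) \<longlonglongrightarrow> 0"
    proof (rule AE_I2)
      fix t :: real
      \<comment> \<open>A point \<open>t > 0\<close> drops out of the interval once
        \<open>S n < t\<close>; a point \<open>t \<le> 0\<close> never lies in it.\<close>
      have "eventually (\<lambda>n. g t * indicator {0<..<S n} t = 0) sequentially"
      proof (cases "t > 0")
        case True
        then have "eventually (\<lambda>n. S n < t) sequentially"
          using S(3) by (rule order_tendstoD(2)[rotated])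
        then show ?thesis by eventually_elim auto
      qed auto
      then show "(\<lambda>n. g t * indicator {0<..<S n} t) \<longlonglongrightarrow> 0"
        by (rule tendsto_eventually)
    qed
  qed (use assms in auto)
  then show "(\<lambda>n. \<integral>\<^sup>+ t\<in>{0<..<S n}. g t \<partial>lebesgue) \<longlonglongrightarrow> 0" by simp
qed simp

text \<open>For \<open>a \<le> 1\<close> the left side is at most 1; for \<open>a > 1\<close> the
  power grows with the exponent.\<close>

lemma ennreal_powr_real_le_one_plus:
  fixes a p q :: real
  assumes "a \<ge> 0" "0 \<le> p" "p \<le> q"
  shows "ennreal (a powr p) \<le> 1 + ennreal (a powr q)"
proof -
  have "a powr p \<le> 1 + a powr q"
  proof (cases "a \<le> 1")
    case True
    then have "a powr p \<le> 1"
      using assms by (intro powr_le1) auto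
    then show ?thesis by (simp add: add_increasing2)
  next
    case False
    then have "a powr p \<le> a powr q"
      using assms by (intro powr_mono) auto
    then show ?thesis by simp
  qed
  then have "ennreal (a powr p) \<le> ennreal (1 + a powr q)"
    by (rule ennreal_leI)
  then show ?thesis by simp
qed

text \<open>Integrating the bound by one plus the larger power over a compact \<open>K\<close> costs
  only the measure of \<open>K\<close>, which is finite.\<close>

lemma Lp_loc_antimono:
  assumes "0 \<le> p" "p \<le> q"
  shows "(Lp_loc q :: (real ^ 'n \<Rightarrow> 'k :: real_normed_field) set) \<subseteq> Lp_loc p"
proof
  fix f :: "real ^ 'n \<Rightarrow> 'k"
  assume "f \<in> Lp_loc q"
  then have [measurable]: "f \<in> borel_measurable lebesgue"
    and fin: "\<And>K. compact K \<Longrightarrow> (\<integral>\<^sup>+ y\<in>K. ennreal (norm (f y) powr q) \<partial>lebesgue) < \<infinity>"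
    by (auto simp: Lp_loc_def)
  have "(\<integral>\<^sup>+ y\<in>K. ennreal (norm (f y) powr p) \<partial>lebesgue) < \<infinity>" if "compact K" for K
  proof -
    have K [measurable]: "K \<in> sets lebesgue"
      using that by (simp add: borel_compact)
    have "(\<integral>\<^sup>+ y\<in>K. ennreal (norm (f y) powr p) \<partial>lebesgue) \<le>
      (\<integral>\<^sup>+ y. indicator K y + ennreal (norm (f y) powr q) * indicator K y \<partial>lebesgue)"
      using ennreal_powr_real_le_one_plus[OF norm_ge_zero assms]
      by (intro nn_integral_mono) (auto split: split_indicator)
    also have "\<dots> = emeasure lebesgue K + (\<integral>\<^sup>+ y\<in>K. ennreal (norm (f y) powr q) \<partial>lebesgue)"
      by (subst nn_integral_add) auto
    also have "\<dots> < \<infinity>"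
      using fin[OF that] emeasure_compact_finite[OF that] that by (simp add: borel_compact)
    finally show ?thesis .
  qed
  then show "f \<in> Lp_loc p" by (simp add: Lp_loc_def)
qed

section \<open>The bare kernel\<close>

lemma borel_measurable_div_id:
  fixes \<Psi> :: "real \<Rightarrow> real"
  assumes "\<Psi> \<in> borel_measurable (lebesgue_on {0<..})"
  shows "(\<lambda>t. ennreal (\<Psi> t / t) * indicator {0<..<r} t) \<in> borel_measurable lebesgue"
proof -
  \<comment> \<open>\<Psi> is known to be measurable only on the positive half-line, so it is
    extended by 0; the indicator of \<open>{0<..<r}\<close> hides the extension.\<close>
  have "(\<lambda>t. if t \<in> {0<..} then \<Psi> t else 0) \<in> borel_measurable lebesgue"
    using assms by (intro borel_measurable_if_I) auto
  moreover have "(\<lambda>t. t) \<in> borel_measurable (lebesgue :: real measure)"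
    by (intro measurable_completion) simp
  ultimately have "(\<lambda>t. ennreal ((if t \<in> {0<..} then \<Psi> t else 0) / t) * indicator {0<..<r} t)
      \<in> borel_measurable lebesgue"
    by (intro borel_measurable_times_ennreal borel_measurable_indicator
        measurable_compose[OF _ measurable_ennreal] borel_measurable_divide) auto
  also have "(\<lambda>t. ennreal ((if t \<in> {0<..} then \<Psi> t else 0) / t) * indicator {0<..<r} t) =
      (\<lambda>t. ennreal (\<Psi> t / t) * indicator {0<..<r} t)"
    by (auto simp: indicator_def)
  finally show ?thesis .
qed

text \<open>In polar coordinates the weight \<open>t ^ (CARD('n) - 1)\<close> meets the denominator
  \<open>t ^ CARD('n)\<close> and leaves \<open>1 / t\<close>. The resulting value does not involve
  the centre \<open>x\<close>.\<close>

lemma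
  fixes \<Psi> :: "real \<Rightarrow> real" and x :: "real ^ 'n" and r :: real
  assumes "\<Psi> \<in> borel_measurable (lebesgue_on {0<..})"
  shows borel_measurable_stummel_kernel:
      "(\<lambda>y. ennreal (\<Psi> (norm (x - y)) / norm (x - y) ^ CARD('n)) * indicator {y. norm (x - y) < r} y)
        \<in> borel_measurable lebesgue" (is ?meas)
    and nn_integral_stummel_kernel:
      "(\<integral>\<^sup>+ y\<in>{y. norm (x - y) < r}. ennreal (\<Psi> (norm (x - y)) / norm (x - y) ^ CARD('n)) \<partial>lebesgue) =
        ennreal (CARD('n) * unit_ball_vol CARD('n)) * (\<integral>\<^sup>+ t\<in>{0<..<r}. ennreal (\<Psi> t / t) \<partial>lebesgue)" (is ?int)
proof -
  let ?g = "\<lambda>t. (if t \<in> {0<..} then \<Psi> t else 0) / t ^ CARD('n) * indicator {..<r} t"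
  have P: "(\<lambda>t. if t \<in> {0<..} then \<Psi> t else 0) \<in> borel_measurable lebesgue"
    using assms by (intro borel_measurable_if_I) auto
  have t: "(\<lambda>t. t) \<in> borel_measurable (lebesgue :: real measure)"
    by (intro measurable_completion) simp
  have g: "?g \<in> borel_measurable lebesgue"
    by (intro borel_measurable_times borel_measurable_indicator
        borel_measurable_divide borel_measurable_power P t) auto
  \<comment> \<open>At \<open>y = x\<close> both sides are 0: the left one because
    \<open>CARD('n)\<close> is positive and division by zero gives 0, the right one because the
    extended \<Psi> vanishes at 0.\<close>
  have eq: "(\<lambda>y. ennreal (\<Psi> (norm (x - y)) / norm (x - y) ^ CARD('n)) * indicator {y. norm (x - y) < r} y)
      = (\<lambda>y. ennreal (?g (norm (x - y))))"
    by (intro ext) (simp add: power_0_left split: split_indicator)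
  show ?meas
    unfolding eq by (rule measurable_compose[OF borel_measurable_lebesgue_radial[OF g] measurable_ennreal])
  have "(\<integral>\<^sup>+ y. ennreal (?g (norm (x - y))) \<partial>lebesgue) = (\<integral>\<^sup>+ t\<in>{0..}.
    ennreal (CARD('n) * unit_ball_vol CARD('n) * t ^ (CARD('n) - 1) * ?g t) \<partial>lebesgue)"
    using nn_integral_lebesgue_radial[OF g, of x] by simp
  also have "\<dots> = (\<integral>\<^sup>+ t. ennreal (CARD('n) * unit_ball_vol CARD('n)) *
     (ennreal (\<Psi> t / t) * indicator {0<..<r} t) \<partial>lebesgue)"
  proof (rule nn_integral_cong)
    fix t :: real
    show "ennreal (CARD('n) * unit_ball_vol CARD('n) * t ^ (CARD('n) - 1) * ?g t) * indicator {0..} t =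
      ennreal (CARD('n) * unit_ball_vol CARD('n)) * (ennreal (\<Psi> t / t) * indicator {0<..<r} t)"
    proof (cases "0 < t \<and> t < r")
      case True
      have "t ^ CARD('n) = t * t ^ (CARD('n) - 1)"
        by (simp flip: power_Suc)
      then have "t ^ (CARD('n) - 1) * ?g t = \<Psi> t / t"
        using True by simp
      then have "ennreal (CARD('n) * unit_ball_vol CARD('n) * t ^ (CARD('n) - 1) * ?g t) =
          ennreal (CARD('n) * unit_ball_vol CARD('n) * (\<Psi> t / t))"
        by (simp only: mult.assoc)
      also have "\<dots> = ennreal (CARD('n) * unit_ball_vol CARD('n)) * ennreal (\<Psi> t / t)"
        by (rule ennreal_mult') simp
      finally have "ennreal (CARD('n) * unit_ball_vol CARD('n) * t ^ (CARD('n) - 1) * ?g t) =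
          ennreal (CARD('n) * unit_ball_vol CARD('n)) * ennreal (\<Psi> t / t)" .
      moreover have "indicator {0..} t = (1 :: ennreal)" "indicator {0<..<r} t = (1 :: ennreal)"
        using True by auto
      ultimately show ?thesis
        by (simp only: mult_1_right)
    next
      case False
      then show ?thesis by (auto simp: indicator_def)
    qed
  qed
  also have "\<dots> = ennreal (CARD('n) * unit_ball_vol CARD('n)) * (\<integral>\<^sup>+ t\<in>{0<..<r}. ennreal (\<Psi> t / t) \<partial>lebesgue)"
    by (rule nn_integral_cmult[OF borel_measurable_div_id[OF assms]])
  finally show ?int unfolding eq .
qed

section \<open>Inclusion of the Stummel classes\<close>

theorem proposition3p4:
  fixes p1 p2 :: real and \<Psi> :: "real \<Rightarrow> real"
  assumes "1 \<le> p2" and "p2 \<le> p1"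
    and "\<Psi> \<in> borel_measurable (lebesgue_on {0<..})"
    and "\<And>t. t > 0 \<Longrightarrow> \<Psi> t > 0"
    and "(\<integral>\<^sup>+ t\<in>{0<..<1}. ennreal (\<Psi> t / t) \<partial>lebesgue) < \<infinity>"
  shows "(stummel_class p1 \<Psi> :: (real ^ 'n \<Rightarrow> 'k :: real_normed_field) set) \<subseteq> stummel_class p2 \<Psi>"
proof
  fix f :: "real ^ 'n \<Rightarrow> 'k"
  assume f: "f \<in> stummel_class p1 \<Psi>"
  then have [measurable]: "f \<in> borel_measurable lebesgue"
    by (simp add: stummel_class_def Lp_loc_def)
  define I where "I p r x = (\<integral>\<^sup>+ y\<in>{y. norm (x - y) < r}.
      ennreal (norm (f y) powr p * \<Psi> (norm (x - y)) / norm (x - y) ^ CARD('n)) \<partial>lebesgue)" for p r x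
  define K where "K r = ennreal (CARD('n) * unit_ball_vol CARD('n)) *
      (\<integral>\<^sup>+ t\<in>{0<..<r}. ennreal (\<Psi> t / t) \<partial>lebesgue)" for r
  \<comment> \<open>The error term \<open>K r\<close> is free of \<open>x\<close>, so this bound
    preserves smallness uniformly in the centre.\<close>
  have I_le: "I p2 r x \<le> K r + I p1 r x" for r x
  proof -
    let ?k = "\<lambda>y. ennreal (\<Psi> (norm (x - y)) / norm (x - y) ^ CARD('n)) * indicator {y. norm (x - y) < r} y"
    have [measurable]: "?k \<in> borel_measurable lebesgue"
      by (rule borel_measurable_stummel_kernel[OF assms(3)])
    have I: "I p r x = (\<integral>\<^sup>+ y. ennreal (norm (f y) powr p) * ?k y \<partial>lebesgue)" for p
      unfolding I_def by (simp add: ennreal_mult' mult.assoc flip: times_divide_eq_right)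
    have "I p2 r x \<le> (\<integral>\<^sup>+ y. ?k y + ennreal (norm (f y) powr p1) * ?k y \<partial>lebesgue)"
      unfolding I
    proof (rule nn_integral_mono)
      fix y
      have "ennreal (norm (f y) powr p2) \<le> 1 + ennreal (norm (f y) powr p1)"
        using assms(1,2) by (intro ennreal_powr_real_le_one_plus) auto
      then have "ennreal (norm (f y) powr p2) * ?k y \<le> (1 + ennreal (norm (f y) powr p1)) * ?k y"
        by (rule mult_right_mono) simp
      then show "ennreal (norm (f y) powr p2) * ?k y \<le> ?k y + ennreal (norm (f y) powr p1) * ?k y"
        by (simp only: distrib_right mult_1)
    qed
    also have "\<dots> = K r + I p1 r x"
      \<comment> \<open>\<open>K r\<close> is turned back into the kernel integral centred at this
        particular \<open>x\<close>, so that additivity of the integral applies.\<close>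
      unfolding I K_def nn_integral_stummel_kernel[OF assms(3), symmetric, of _ x]
      by (rule nn_integral_add) measurable
    finally show ?thesis .
  qed
  have "((\<lambda>r. \<integral>\<^sup>+ t\<in>{0<..<r}. ennreal (\<Psi> t / t) \<partial>lebesgue) \<longlongrightarrow> 0) (at_right 0)"
    by (rule nn_integral_near_0_tendsto_0[OF borel_measurable_div_id[OF assms(3)] assms(5)])
  \<comment> \<open>The constant is finite, hence multiplication by it preserves the limit.\<close>
  then have "(K \<longlongrightarrow> ennreal (CARD('n) * unit_ball_vol CARD('n)) * 0) (at_right 0)"
    unfolding K_def by (intro ennreal_tendsto_cmult) auto
  then have K: "(K \<longlongrightarrow> 0) (at_right 0)" by simp
  have "\<forall>e>0. eventually (\<lambda>r. \<forall>x. I p2 r x \<le> ennreal e) (at_right 0)"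
  proof (intro allI impI)
    fix e :: real assume "e > 0"
    \<comment> \<open>Half of \<open>e\<close> goes to the kernel term and half to the integrals
      with exponent \<open>p1\<close>; the latter bound is membership in the class for
      \<open>p1\<close>.\<close>
    have "eventually (\<lambda>r. K r \<le> ennreal (e / 2)) (at_right 0)"
      using K \<open>e > 0\<close> by (simp add: ennreal_tendsto_0_iff_le)
    moreover have "eventually (\<lambda>r. \<forall>x. I p1 r x \<le> ennreal (e / 2)) (at_right 0)"
      using f \<open>e > 0\<close> assms(1,2) by (simp add: stummel_class_def stummel_modulus_tendsto_0_iff I_def)
    ultimately show "eventually (\<lambda>r. \<forall>x. I p2 r x \<le> ennreal e) (at_right 0)"
    proof eventually_elim
      case (elim r)
      have "I p2 r x \<le> ennreal (e / 2) + ennreal (e / 2)" for x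
        using I_le[of r x] elim by (meson add_mono order_trans)
      then show ?case
        using \<open>e > 0\<close> by (simp flip: ennreal_plus)
    qed
  qed
  then show "f \<in> stummel_class p2 \<Psi>"
    using f Lp_loc_antimono[of p2 p1] assms(1,2)
    by (auto simp: stummel_class_def stummel_modulus_tendsto_0_iff I_def)
qed

end
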